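(* Let $X$ be a path connected, locally path connected, metrizable, homotopically Hausdorff space and let $x_0\in X$. Then $\pi_1^{wh}(X,x_0)$ is a homogeneous, zero-dimensional, metrizable space.
   Context: For a based space $(X,x_0)$, $\pi_1^{wh}(X,x_0)$ denotes the fundamental group $\pi_1(X,x_0)$ with the whisker topology: the topology having as a basis the sets $B([\zeta],U)=\{[\zeta\cdot\eta] : \eta \text{ a loop based at } x_0 \text{ with image contained in } U\}$, where $[\zeta]\in\pi_1(X,x_0)$ and $U$ is an open neighborhood of $x_0$ in $X$. Here $\zeta\cdot\eta$ is path concatenation. A space $X$ is homotopically Hausdorff at $x\in X$ if for every $[\zeta]\in\pi_1(X,x)\setminus\{1\}$ there is an open neighborhood $U$ of $x$ such that $[\zeta]\notin i_{\#}(\pi_1(U,x))$, where $i:U\to X$ is the inclusion; $X$ is homotopically Hausdorff if it is so at each of its points. Zero-dimensional is in the sense of small inductive dimension: the space has a basis of clopen sets. A space is homogeneous if for any two points some self-homeomorphism takes one to the other. *)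

theory Defs
  imports "HOL-Analysis.Analysis"
begin

text \<open>
  Spaces are subsets \<open>S\<close> of a type of class \<^class>\<open>topological_space\<close>, carrying the subspace
  topology \<open>top_of_set S\<close>.
\<close>

section \<open>The fundamental group\<close>

definition loops_at :: "'a::topological_space set \<Rightarrow> 'a \<Rightarrow> (real \<Rightarrow> 'a) set" where
  "loops_at S x = {p. path p \<and> path_image p \<subseteq> S \<and> pathstart p = x \<and> pathfinish p = x}"

definition loop_class :: "'a::topological_space set \<Rightarrow> (real \<Rightarrow> 'a) \<Rightarrow> (real \<Rightarrow> 'a) set" where
  "loop_class S p = {q. homotopic_paths S p q}"

definition pi1 :: "'a::topological_space set \<Rightarrow> 'a \<Rightarrow> (real \<Rightarrow> 'a) set set" where
  "pi1 S x = loop_class S ` loops_at S x"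

definition pi1_one :: "'a::topological_space set \<Rightarrow> 'a \<Rightarrow> (real \<Rightarrow> 'a) set" where
  "pi1_one S x = loop_class S (\<lambda>t. x)"

text \<open>
  The homomorphism induced by an inclusion \<open>U \<subseteq> S\<close>: all members of a class \<open>c\<close> of loops in \<open>U\<close>
  are homotopic in \<open>S\<close>, so the union below is a single class; see \<open>pi1_incl_loop_class\<close>.
\<close>

definition pi1_incl :: "'a::topological_space set \<Rightarrow> (real \<Rightarrow> 'a) set \<Rightarrow> (real \<Rightarrow> 'a) set" where
  "pi1_incl S c = (\<Union>p\<in>c. loop_class S p)"

lemma loop_class_eq_iff:
  assumes "path p" "path_image p \<subseteq> S"
  shows "loop_class S p = loop_class S q \<longleftrightarrow> homotopic_paths S p q"
proof
  assume "loop_class S p = loop_class S q"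
  moreover have "p \<in> loop_class S p"
    using assms by (simp add: loop_class_def)
  ultimately show "homotopic_paths S p q"
    by (simp add: loop_class_def homotopic_paths_sym)
next
  assume "homotopic_paths S p q"
  then show "loop_class S p = loop_class S q"
    unfolding loop_class_def by (blast intro: homotopic_paths_sym homotopic_paths_trans)
qed

lemma pi1_incl_loop_class:
  assumes "p \<in> loops_at U x" "U \<subseteq> S"
  shows "pi1_incl S (loop_class U p) = loop_class S p"
proof -
  have p: "path p" "path_image p \<subseteq> U"
    using assms by (auto simp: loops_at_def)
  have "loop_class S q = loop_class S p" if "q \<in> loop_class U p" for q
  proof -
    have "homotopic_paths S p q"
      using that assms(2) by (auto simp: loop_class_def intro: homotopic_paths_subset)
    then show ?thesis
      using loop_class_eq_iff[of p S q] p assms(2) by auto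
  qed
  moreover have "p \<in> loop_class U p"
    using p by (simp add: loop_class_def)
  ultimately show ?thesis
    unfolding pi1_incl_def by blast
qed

section \<open>The whisker topology\<close>

definition whisker_basic ::
    "'a::topological_space set \<Rightarrow> 'a \<Rightarrow> (real \<Rightarrow> 'a) \<Rightarrow> 'a set \<Rightarrow> (real \<Rightarrow> 'a) set set" where
  "whisker_basic S x0 \<zeta> U = {loop_class S (\<zeta> +++ \<eta>) | \<eta>. \<eta> \<in> loops_at U x0}"

definition whisker_basis ::
    "'a::topological_space set \<Rightarrow> 'a \<Rightarrow> (real \<Rightarrow> 'a) set set set" where
  "whisker_basis S x0 =
     {whisker_basic S x0 \<zeta> U | \<zeta> U. \<zeta> \<in> loops_at S x0 \<and> openin (top_of_set S) U \<and> x0 \<in> U}"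

definition pi1_wh :: "'a::topological_space set \<Rightarrow> 'a \<Rightarrow> (real \<Rightarrow> 'a) set topology" where
  "pi1_wh S x0 = topology (arbitrary union_of (\<lambda>W. W \<in> whisker_basis S x0))"

text \<open>
  The sets \<open>whisker_basic S x0 \<zeta> U\<close> depend only on the class of \<open>\<zeta>\<close>, and they do form a basis of a
  topology on \<open>pi1 S x0\<close>, so that \<^const>\<open>pi1_wh\<close> is not an arbitrary value of \<^const>\<open>topology\<close>.
\<close>

lemma whisker_basic_cong:
  assumes "U \<subseteq> S" "\<zeta> \<in> loops_at S x0" "homotopic_paths S \<zeta> \<zeta>'"
  shows "whisker_basic S x0 \<zeta> U = whisker_basic S x0 \<zeta>' U"
proof -
  have "loop_class S (\<zeta> +++ \<eta>) = loop_class S (\<zeta>' +++ \<eta>)" if "\<eta> \<in> loops_at U x0" for \<eta>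
  proof -
    have "homotopic_paths S (\<zeta> +++ \<eta>) (\<zeta>' +++ \<eta>)"
      using assms that by (intro homotopic_paths_join) (auto simp: loops_at_def)
    then show ?thesis
      using homotopic_paths_imp_path homotopic_paths_imp_subset loop_class_eq_iff by metis
  qed
  then show ?thesis
    unfolding whisker_basic_def by (metis (no_types, lifting))
qed

lemma loops_at_join:
  assumes "p \<in> loops_at S x" "q \<in> loops_at S x"
  shows "p +++ q \<in> loops_at S x"
  using assms by (auto simp: loops_at_def path_image_join)

lemma loops_at_mono: "U \<subseteq> S \<Longrightarrow> loops_at U x \<subseteq> loops_at S x"
  by (auto simp: loops_at_def)

lemma loops_at_const: "x \<in> S \<Longrightarrow> (\<lambda>t. x) \<in> loops_at S x"
  by (auto simp: loops_at_def path_def path_image_def pathstart_def pathfinish_def)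

lemma homotopic_paths_const_right:
  assumes "p \<in> loops_at S x"
  shows "homotopic_paths S (p +++ (\<lambda>t. x)) p"
proof -
  let ?f = "\<lambda>t::real. if t \<le> 1/2 then 2 * t else 1"
  have "continuous_on {0..1} ?f"
    unfolding split_01 by (rule continuous_on_cases continuous_intros | force)+
  then have "homotopic_paths S p (p +++ (\<lambda>t. x))"
    using assms
    by (intro homotopic_paths_reparametrize[where f = ?f])
       (auto simp: loops_at_def joinpaths_def pathfinish_def)
  then show ?thesis
    by (rule homotopic_paths_sym)
qed

lemma whisker_basic_self:
  assumes "\<zeta> \<in> loops_at S x0" "x0 \<in> U"
  shows "loop_class S \<zeta> \<in> whisker_basic S x0 \<zeta> U"
proof -
  have "loop_class S \<zeta> = loop_class S (\<zeta> +++ (\<lambda>t. x0))"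
    using homotopic_paths_const_right[OF assms(1)] assms(1) loop_class_eq_iff
    by (metis (no_types, lifting) homotopic_paths_sym loops_at_def mem_Collect_eq)
  then show ?thesis
    using loops_at_const[OF assms(2)] unfolding whisker_basic_def by blast
qed

lemma whisker_basic_absorb:
  assumes "U \<subseteq> S" "V \<subseteq> U" "\<zeta> \<in> loops_at S x0" "\<xi> \<in> loops_at S x0"
    and "loop_class S \<xi> \<in> whisker_basic S x0 \<zeta> U"
  shows "whisker_basic S x0 \<xi> V \<subseteq> whisker_basic S x0 \<zeta> U"
proof
  fix c assume "c \<in> whisker_basic S x0 \<xi> V"
  then obtain \<mu> where \<mu>: "\<mu> \<in> loops_at V x0" "c = loop_class S (\<xi> +++ \<mu>)"
    by (auto simp: whisker_basic_def)
  from assms(5) obtain \<eta> where \<eta>: "\<eta> \<in> loops_at U x0" "loop_class S \<xi> = loop_class S (\<zeta> +++ \<eta>)"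
    by (auto simp: whisker_basic_def)
  have \<mu>U: "\<mu> \<in> loops_at U x0" and in_S: "\<mu> \<in> loops_at S x0" "\<eta> \<in> loops_at S x0"
    using loops_at_mono \<mu>(1) \<eta>(1) assms(1,2) by blast+
  have "homotopic_paths S \<xi> (\<zeta> +++ \<eta>)"
    using \<eta>(2) assms(4) by (subst loop_class_eq_iff[symmetric]) (auto simp: loops_at_def)
  then have "homotopic_paths S (\<xi> +++ \<mu>) ((\<zeta> +++ \<eta>) +++ \<mu>)"
    using in_S assms(4) by (intro homotopic_paths_join) (auto simp: loops_at_def)
  also have "homotopic_paths S \<dots> (\<zeta> +++ (\<eta> +++ \<mu>))"
    using in_S assms(3) by (intro homotopic_paths_sym[OF homotopic_paths_assoc]) (auto simp: loops_at_def)
  finally have "loop_class S (\<xi> +++ \<mu>) = loop_class S (\<zeta> +++ (\<eta> +++ \<mu>))"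
    using homotopic_paths_imp_path homotopic_paths_imp_subset loop_class_eq_iff by metis
  then show "c \<in> whisker_basic S x0 \<zeta> U"
    using loops_at_join[OF \<eta>(1) \<mu>U] \<mu>(2) unfolding whisker_basic_def by blast
qed

lemma whisker_basic_subset:
  assumes "U \<subseteq> S" "\<zeta> \<in> loops_at S x0"
  shows "whisker_basic S x0 \<zeta> U \<subseteq> pi1 S x0"
  using loops_at_join[OF assms(2)] loops_at_mono[OF assms(1)]
  unfolding whisker_basic_def pi1_def by blast

lemma istopology_whisker_basis:
  "istopology (arbitrary union_of (\<lambda>W. W \<in> whisker_basis S x0))"
  unfolding istopology_base_eq
proof (intro allI impI)
  fix A B assume AB: "A \<in> whisker_basis S x0 \<and> B \<in> whisker_basis S x0"
  obtain \<zeta> U where A: "A = whisker_basic S x0 \<zeta> U" "\<zeta> \<in> loops_at S x0"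
      "openin (top_of_set S) U" "x0 \<in> U"
    using AB by (auto simp: whisker_basis_def)
  obtain \<zeta>' V where B: "B = whisker_basic S x0 \<zeta>' V" "\<zeta>' \<in> loops_at S x0"
      "openin (top_of_set S) V" "x0 \<in> V"
    using AB by (auto simp: whisker_basis_def)
  have US: "U \<subseteq> S" "V \<subseteq> S"
    using A(3) B(3) openin_imp_subset by blast+
  have "\<exists>W\<in>whisker_basis S x0. c \<in> W \<and> W \<subseteq> A \<inter> B" if c: "c \<in> A \<inter> B" for c
  proof -
    have "c \<in> pi1 S x0"
      using c A whisker_basic_subset US by blast
    then obtain \<xi> where \<xi>: "\<xi> \<in> loops_at S x0" "c = loop_class S \<xi>"
      by (auto simp: pi1_def)
    have "whisker_basic S x0 \<xi> (U \<inter> V) \<in> whisker_basis S x0"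
      using \<xi> A B unfolding whisker_basis_def by blast
    moreover have "whisker_basic S x0 \<xi> (U \<inter> V) \<subseteq> A" "whisker_basic S x0 \<xi> (U \<inter> V) \<subseteq> B"
      using whisker_basic_absorb[OF US(1) _ A(2) \<xi>(1)] whisker_basic_absorb[OF US(2) _ B(2) \<xi>(1)]
        c \<xi> A B by auto
    moreover have "c \<in> whisker_basic S x0 \<xi> (U \<inter> V)"
      using whisker_basic_self[OF \<xi>(1)] \<xi>(2) A(4) B(4) by blast
    ultimately show ?thesis by blast
  qed
  then have "\<Union> {W \<in> whisker_basis S x0. W \<subseteq> A \<inter> B} = A \<inter> B"
    by blast
  then show "(arbitrary union_of (\<lambda>W. W \<in> whisker_basis S x0)) (A \<inter> B)"
    unfolding union_of_def arbitrary_def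
    by (intro exI[of _ "{W \<in> whisker_basis S x0. W \<subseteq> A \<inter> B}"]) auto
qed

lemma openin_pi1_wh:
  "openin (pi1_wh S x0) = arbitrary union_of (\<lambda>W. W \<in> whisker_basis S x0)"
  unfolding pi1_wh_def using istopology_whisker_basis by (rule topology_inverse')

lemma topspace_pi1_wh: "topspace (pi1_wh S x0) = pi1 S x0"
proof
  show "topspace (pi1_wh S x0) \<subseteq> pi1 S x0"
  proof
    fix c assume "c \<in> topspace (pi1_wh S x0)"
    then obtain W where "W \<in> whisker_basis S x0" "c \<in> W"
      using openin_topspace[of "pi1_wh S x0"] unfolding openin_pi1_wh union_of_def arbitrary_def
      by (auto simp: subset_iff) (metis UnionE)
    then show "c \<in> pi1 S x0"
      unfolding whisker_basis_def using whisker_basic_subset openin_imp_subset by blast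
  qed
  show "pi1 S x0 \<subseteq> topspace (pi1_wh S x0)"
  proof
    fix c assume "c \<in> pi1 S x0"
    then obtain \<xi> where \<xi>: "\<xi> \<in> loops_at S x0" "c = loop_class S \<xi>"
      by (auto simp: pi1_def)
    then have "x0 \<in> S"
      by (auto simp: loops_at_def)
    have "openin (top_of_set S) S"
      by simp
    then have "whisker_basic S x0 \<xi> S \<in> whisker_basis S x0"
      using \<xi>(1) \<open>x0 \<in> S\<close> unfolding whisker_basis_def by blast
    then have "openin (pi1_wh S x0) (whisker_basic S x0 \<xi> S)"
      unfolding openin_pi1_wh by (simp add: arbitrary_def union_of_inc)
    then show "c \<in> topspace (pi1_wh S x0)"
      using whisker_basic_self[OF \<xi>(1) \<open>x0 \<in> S\<close>] \<xi>(2) openin_subset by blast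
  qed
qed

section \<open>Topological properties\<close>

definition homotopically_hausdorff_at :: "'a::topological_space set \<Rightarrow> 'a \<Rightarrow> bool" where
  "homotopically_hausdorff_at S x \<longleftrightarrow>
     (\<forall>c \<in> pi1 S x - {pi1_one S x}.
        \<exists>U. openin (top_of_set S) U \<and> x \<in> U \<and> c \<notin> pi1_incl S ` pi1 U x)"

definition homotopically_hausdorff :: "'a::topological_space set \<Rightarrow> bool" where
  "homotopically_hausdorff S \<longleftrightarrow> (\<forall>x\<in>S. homotopically_hausdorff_at S x)"

definition homogeneous_space :: "'a topology \<Rightarrow> bool" where
  "homogeneous_space X \<longleftrightarrow>
     (\<forall>x\<in>topspace X. \<forall>y\<in>topspace X. \<exists>f. homeomorphic_map X X f \<and> f x = y)"

definition zero_dimensional_space :: "'a topology \<Rightarrow> bool" where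
  "zero_dimensional_space X \<longleftrightarrow>
     (\<exists>\<B>. (\<forall>B\<in>\<B>. openin X B \<and> closedin X B) \<and> openin X = arbitrary union_of (\<lambda>B. B \<in> \<B>))"

lemma zero_dimensional_space_iff_dim_le: "zero_dimensional_space X \<longleftrightarrow> X dim_le 0"
proof -
  have "X dim_le 0 \<longleftrightarrow>
      (\<forall>W x. openin X W \<and> x \<in> W \<longrightarrow> (\<exists>U. openin X U \<and> closedin X U \<and> x \<in> U \<and> U \<subseteq> W))"
    unfolding dimension_le_0_neighbourhood_base_of_clopen
    by (subst open_neighbourhood_base_of) (simp, metis)
  also have "\<dots> \<longleftrightarrow> zero_dimensional_space X"
    unfolding zero_dimensional_space_def openin_topology_base_unique
  proof (intro iffI, goal_cases)
    case 1
    then show ?case by (intro exI[of _ "{B. openin X B \<and> closedin X B}"]) blast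
  next
    case 2
    then show ?case by (elim exE conjE) meson
  qed
  finally show ?thesis by blast
qed

end

theory Submission
  imports Defs
begin

text \<open>
  Fix a neighbourhood \<open>U\<close> of \<open>x0\<close>. The classes of loops that stay inside \<open>U\<close> form a subgroup of
  the fundamental group, and the basic whisker neighbourhoods belonging to \<open>U\<close> are exactly the
  left cosets of that subgroup. So the whisker topology comes from a family of partitions of the
  fundamental group into left cosets, one partition for each \<open>U\<close>, refining each other as \<open>U\<close>
  shrinks. The three claims follow from this picture.

  A left translation permutes the left cosets of every subgroup. It is therefore continuous with
  respect to the whisker topology, and so is the inverse translation; as left translations act
  transitively, the space is homogeneous.

  The complement of a coset is a union of cosets of the same subgroup. Hence the basic sets are
  clopen (\<open>zero_dimensional_space_if_equivs\<close>).

  When the base space is metrizable, the balls around \<open>x0\<close> of radius \<open>1 / (n + 1)\<close> give a decreasing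
  sequence of partitions that already determines the topology. Being homotopically Hausdorff at
  \<open>x0\<close> says that only the trivial class lies in all of the subgroups, i.e. that the partitions
  together separate points. A separating decreasing sequence of partitions defines an ultrametric:
  two points are closer the later they fall into different parts (\<open>metrizable_space_if_equivs\<close>).
\<close>

section \<open>Topologies given by equivalence relations\<close>

lemma zero_dimensional_space_if_equivs:
  fixes T :: "'a topology"
  assumes equiv: "\<And>E. E \<in> \<E> \<Longrightarrow> equiv M E"
    and opn: "\<And>W. openin T W \<longleftrightarrow> W \<subseteq> M \<and> (\<forall>x\<in>W. \<exists>E\<in>\<E>. E `` {x} \<subseteq> W)"
  shows "zero_dimensional_space T"
proof -
  let ?\<B> = "{E `` {x} | E x. E \<in> \<E> \<and> x \<in> M}"
  have open_class: "openin T (E `` {x})" if "E \<in> \<E>" for E x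
    unfolding opn
  proof (intro conjI ballI bexI)
    show "E `` {x} \<subseteq> M"
      using equiv[OF that] by (auto simp: equiv_def refl_on_def)
    show "E `` {y} \<subseteq> E `` {x}" if "y \<in> E `` {x}" for y
      using that equiv[OF \<open>E \<in> \<E>\<close>] by (auto simp: equiv_def dest: transD)
  qed (rule that)
  have open_compl: "openin T (M - E `` {x})" if "E \<in> \<E>" for E x
    unfolding opn
  proof (intro conjI ballI bexI)
    show "E `` {y} \<subseteq> M - E `` {x}" if "y \<in> M - E `` {x}" for y
      using that equiv[OF \<open>E \<in> \<E>\<close>]
      by (auto simp: equiv_def refl_on_def dest: transD symD)
  qed (use that in auto)
  have sub: "topspace T \<subseteq> M"
    using opn[of "topspace T"] by simp
  have clopen: "openin T B \<and> closedin T B" if B: "B \<in> ?\<B>" for B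
  proof -
    obtain E x where E: "E \<in> \<E>" "B = E `` {x}"
      using B by blast
    have o: "openin T B" "openin T (M - B)"
      using open_class open_compl E by auto
    then have "B \<subseteq> topspace T" "M - B \<subseteq> topspace T"
      using openin_subset by blast+
    then have "topspace T - B = M - B"
      using sub by blast
    then show ?thesis
      using o \<open>B \<subseteq> topspace T\<close> by (simp add: closedin_def)
  qed
  have "openin T = arbitrary union_of (\<lambda>B. B \<in> ?\<B>)"
    unfolding openin_topology_base_unique
  proof (intro conjI allI impI, goal_cases)
    case (1 V)
    then show ?case using clopen by blast
  next
    case (2 W x)
    then obtain E where E: "E \<in> \<E>" "E `` {x} \<subseteq> W" "x \<in> M"
      using opn by blast
    then have "x \<in> E `` {x}"
      using equiv_class_self[OF equiv[OF E(1)]] by blast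
    then show ?case using E by blast
  qed
  then show ?thesis
    unfolding zero_dimensional_space_def using clopen by blast
qed

text \<open>
  The ultrametric assigns to distinct points the distance \<open>1 / (n + 1)\<close>, where \<open>n\<close> is the
  first index at which they are inequivalent. The class of \<open>x\<close> under \<open>E n\<close> is then the open
  ball of radius \<open>1 / (n + 1)\<close> around \<open>x\<close>.
\<close>

lemma metrizable_space_if_equivs:
  fixes T :: "'a topology"
  assumes equiv: "\<And>n. equiv M (E n)"
    and dec: "decseq E"
    and sep: "(\<Inter>n. E n) \<subseteq> Id"
    and opn: "\<And>W. openin T W \<longleftrightarrow> W \<subseteq> M \<and> (\<forall>x\<in>W. \<exists>n. E n `` {x} \<subseteq> W)"
  shows "metrizable_space T"
proof -
  define first where "first x y = (LEAST n. (x, y) \<notin> E n)" for x y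
  define d :: "'a \<Rightarrow> 'a \<Rightarrow> real"
    where "d x y = (if x = y then 0 else inverse (real (Suc (first x y))))" for x y
  have d_less: "d x y < inverse (real (Suc n)) \<longleftrightarrow> (x, y) \<in> E n" if "x \<in> M" for x y n
  proof (cases "x = y")
    case True
    then show ?thesis
      using equiv[of n] that by (auto simp: d_def equiv_def refl_on_def)
  next
    case False
    then obtain k where "(x, y) \<notin> E k"
      using sep by blast
    then have notin: "(x, y) \<notin> E (first x y)"
      unfolding first_def by (rule LeastI)
    have "(x, y) \<in> E n \<longleftrightarrow> n < first x y"
    proof
      show "n < first x y" if "(x, y) \<in> E n"
        using notin that decseqD[OF dec, of "first x y" n] by (meson in_mono not_le)
      show "(x, y) \<in> E n" if "n < first x y"
        using that not_less_Least unfolding first_def by blast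
    qed
    then show ?thesis
      using False by (simp add: d_def)
  qed
  have nonneg: "0 \<le> d x y" for x y
    by (simp add: d_def)
  interpret Metric_space M d
  proof
    show "d x y = d y x" for x y
    proof -
      have "(x, y) \<in> E n \<longleftrightarrow> (y, x) \<in> E n" for n
        using equiv[of n] by (auto simp: equiv_def dest: symD)
      then show ?thesis by (simp add: d_def first_def)
    qed
    show "d x y = 0 \<longleftrightarrow> x = y" for x y
      by (simp add: d_def)
    show "d x z \<le> d x y + d y z" if "x \<in> M" "y \<in> M" "z \<in> M" for x y z
    proof (rule ccontr)
      assume less: "\<not> d x z \<le> d x y + d y z"
      then have "x \<noteq> z"
        using nonneg[of x y] nonneg[of y z] by (auto simp: d_def)
      then have xz: "d x z = inverse (real (Suc (first x z)))"
        by (simp add: d_def)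
      \<comment> \<open>Both steps being shorter than \<open>d x z\<close>, they stay within a class of \<open>E (first x z)\<close>,
        at which \<open>x\<close> and \<open>z\<close> are already separated.\<close>
      have "d x y < d x z" "d y z < d x z"
        using less nonneg[of x y] nonneg[of y z] by linarith+
      then have "(x, y) \<in> E (first x z)" "(y, z) \<in> E (first x z)"
        unfolding xz using d_less that by blast+
      then have "(x, z) \<in> E (first x z)"
        using equiv[of "first x z"] by (auto simp: equiv_def dest: transD)
      then show False
        using d_less[of x z "first x z"] xz that by simp
    qed
  qed (rule nonneg)
  have ball: "mball x (inverse (real (Suc n))) = E n `` {x}" if "x \<in> M" for x n
    using d_less[OF that] that equiv[of n] by (auto simp: equiv_def refl_on_def)
  have "openin mtopology W \<longleftrightarrow> openin T W" for W
    unfolding openin_mtopology opn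
  proof (intro conj_cong refl iffI allI impI ballI)
    assume W: "W \<subseteq> M"
    {
      fix x assume "\<forall>x. x \<in> W \<longrightarrow> (\<exists>r>0. mball x r \<subseteq> W)" "x \<in> W"
      then obtain r where r: "r > 0" "mball x r \<subseteq> W"
        by blast
      obtain n where "inverse (real (Suc n)) < r"
        using reals_Archimedean[OF r(1)] by blast
      then have "mball x (inverse (real (Suc n))) \<subseteq> W"
        using r(2) mball_subset_concentric[of "inverse (real (Suc n))" r x] by simp
      then show "\<exists>n. E n `` {x} \<subseteq> W"
        using ball \<open>x \<in> W\<close> W by blast
    next
      fix x assume "\<forall>x\<in>W. \<exists>n. E n `` {x} \<subseteq> W" "x \<in> W"
      then obtain n where "mball x (inverse (real (Suc n))) \<subseteq> W"
        using ball W by blast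
      then show "\<exists>r>0. mball x r \<subseteq> W"
        by (intro exI[of _ "inverse (real (Suc n))"]) simp
    }
  qed
  then have "mtopology = T"
    by (simp add: topology_eq)
  then show ?thesis
    using metrizable_space_mtopology by simp
qed

section \<open>Loops up to homotopy\<close>

lemma loops_at_reverse: "p \<in> loops_at S x \<Longrightarrow> reversepath p \<in> loops_at S x"
  by (auto simp: loops_at_def)

lemma loop_class_eqI: "homotopic_paths S p q \<Longrightarrow> loop_class S p = loop_class S q"
  using homotopic_paths_imp_path homotopic_paths_imp_subset loop_class_eq_iff by metis

lemma loop_class_eqD:
  "loop_class S p = loop_class S q \<Longrightarrow> p \<in> loops_at S x \<Longrightarrow> homotopic_paths S p q"
  using loop_class_eq_iff by (auto simp: loops_at_def)

lemma loop_class_join_cong: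
  assumes "p \<in> loops_at S x" "q \<in> loops_at S x" "p' \<in> loops_at S x" "q' \<in> loops_at S x"
    and "loop_class S p = loop_class S p'" "loop_class S q = loop_class S q'"
  shows "loop_class S (p +++ q) = loop_class S (p' +++ q')"
proof (rule loop_class_eqI, rule homotopic_paths_join)
  show "homotopic_paths S p p'" "homotopic_paths S q q'"
    using assms loop_class_eqD by blast+
  show "pathfinish p = pathstart q"
    using assms by (auto simp: loops_at_def)
qed

lemma loop_class_assoc:
  assumes "p \<in> loops_at S x" "q \<in> loops_at S x" "r \<in> loops_at S x"
  shows "loop_class S (p +++ (q +++ r)) = loop_class S ((p +++ q) +++ r)"
  using assms by (intro loop_class_eqI homotopic_paths_assoc) (auto simp: loops_at_def)

lemma homotopic_paths_const_left:
  assumes "p \<in> loops_at S x"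
  shows "homotopic_paths S ((\<lambda>t. x) +++ p) p"
proof -
  have "reversepath (reversepath p +++ (\<lambda>t. x)) = (\<lambda>t. x) +++ p"
    using assms
    by (subst reversepath_joinpaths)
       (auto simp: loops_at_def reversepath_def pathstart_def pathfinish_def)
  then show ?thesis
    using homotopic_paths_reversepath_D[OF homotopic_paths_const_right[OF loops_at_reverse[OF assms]]]
    by simp
qed

text \<open>
  The loop \<open>p +++ reversepath p\<close> is \<open>p\<close> composed with the tent function \<open>1 - \<bar>2 * t - 1\<bar>\<close>, and
  scaling the tent down to \<open>0\<close> contracts it to the base point.
\<close>

lemma homotopic_paths_join_reverse_const:
  assumes "p \<in> loops_at S x"
  shows "homotopic_paths S (p +++ reversepath p) (\<lambda>t. x)"
proof -
  let ?g = "\<lambda>y::real \<times> real. fst y * (1 - \<bar>2 * snd y - 1\<bar>)"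
  have p: "continuous_on {0..1} p" "p ` {0..1} \<subseteq> S" "p 0 = x" "p 1 = x"
    using assms by (auto simp: loops_at_def path_def path_image_def pathstart_def pathfinish_def)
  have g: "?g ` ({0..1} \<times> {0..1}) \<subseteq> {0..1}"
    by (auto intro!: mult_nonneg_nonneg mult_le_one)
  have tent: "p (1 - \<bar>2 * t - 1\<bar>) = (p +++ reversepath p) t" for t :: real
    by (auto simp: joinpaths_def reversepath_def abs_if intro!: arg_cong[where f = p])
  have "homotopic_paths S (\<lambda>t. x) (p +++ reversepath p)"
    unfolding homotopic_paths
  proof (intro exI conjI ballI)
    show "continuous_on ({0..1} \<times> {0..1}) (p \<circ> ?g)"
      by (intro continuous_on_compose continuous_intros continuous_on_subset[OF p(1) g])
    show "p \<circ> ?g \<in> {0..1} \<times> {0..1} \<rightarrow> S"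
      using g p(2) by (auto simp: image_subset_iff)
    show "(p \<circ> ?g) (1, t) = (p +++ reversepath p) t" for t
      using tent[of t] by simp
  qed (simp_all add: p pathstart_def pathfinish_def)
  then show ?thesis
    by (rule homotopic_paths_sym)
qed

lemma loop_class_reverse_cancel:
  assumes "p \<in> loops_at S x" "q \<in> loops_at S x"
  shows "loop_class S (reversepath p +++ (p +++ q)) = loop_class S q"
proof -
  note rev = loops_at_reverse[OF assms(1)]
  have "homotopic_paths S (reversepath p +++ p) (\<lambda>t. x)"
    using homotopic_paths_join_reverse_const[OF rev] by simp
  then have "homotopic_paths S ((reversepath p +++ p) +++ q) ((\<lambda>t. x) +++ q)"
    using assms by (intro homotopic_paths_join) (auto simp: loops_at_def)
  also have "homotopic_paths S \<dots> q"
    by (rule homotopic_paths_const_left[OF assms(2)])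
  finally show ?thesis
    using loop_class_assoc[OF rev assms] loop_class_eqI by metis
qed

lemma loop_class_cancel_reverse:
  assumes "p \<in> loops_at S x" "q \<in> loops_at S x"
  shows "loop_class S (p +++ (reversepath p +++ q)) = loop_class S q"
  using loop_class_reverse_cancel[OF loops_at_reverse[OF assms(1)] assms(2)] by simp

lemma loop_class_join_reverse_right:
  assumes "p \<in> loops_at S x" "q \<in> loops_at S x"
  shows "loop_class S ((p +++ q) +++ reversepath q) = loop_class S p"
proof -
  have "homotopic_paths S (p +++ (q +++ reversepath q)) (p +++ (\<lambda>t. x))"
    using assms homotopic_paths_join_reverse_const[OF assms(2)]
    by (intro homotopic_paths_join) (auto simp: loops_at_def)
  also have "homotopic_paths S \<dots> p"
    by (rule homotopic_paths_const_right[OF assms(1)])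
  finally show ?thesis
    using loop_class_assoc[OF assms loops_at_reverse[OF assms(2)]] loop_class_eqI by metis
qed

section \<open>The whisker topology as a topology of left cosets\<close>

text \<open>
  Two classes are related iff they lie in the same left coset of the subgroup of all classes of
  loops inside \<open>U\<close>.
\<close>

definition coset_rel ::
    "'a::topological_space set \<Rightarrow> 'a \<Rightarrow> 'a set \<Rightarrow> ((real \<Rightarrow> 'a) set \<times> (real \<Rightarrow> 'a) set) set" where
  "coset_rel S x0 U =
     {(loop_class S \<zeta>, loop_class S (\<zeta> +++ \<eta>)) | \<zeta> \<eta>. \<zeta> \<in> loops_at S x0 \<and> \<eta> \<in> loops_at U x0}"

lemma coset_rel_mono: "U \<subseteq> V \<Longrightarrow> coset_rel S x0 U \<subseteq> coset_rel S x0 V"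
  using loops_at_mono[of U V x0] unfolding coset_rel_def by blast

lemma coset_rel_image:
  assumes "U \<subseteq> S" "\<zeta> \<in> loops_at S x0"
  shows "coset_rel S x0 U `` {loop_class S \<zeta>} = whisker_basic S x0 \<zeta> U"
proof
  show "coset_rel S x0 U `` {loop_class S \<zeta>} \<subseteq> whisker_basic S x0 \<zeta> U"
  proof
    fix c assume "c \<in> coset_rel S x0 U `` {loop_class S \<zeta>}"
    then obtain \<zeta>' \<eta> where *: "\<eta> \<in> loops_at U x0" "loop_class S \<zeta> = loop_class S \<zeta>'"
        "c = loop_class S (\<zeta>' +++ \<eta>)"
      by (auto simp: coset_rel_def)
    then have "c \<in> whisker_basic S x0 \<zeta>' U"
      by (auto simp: whisker_basic_def)
    then show "c \<in> whisker_basic S x0 \<zeta> U"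
      using whisker_basic_cong[OF assms] loop_class_eqD[OF *(2) assms(2)] by blast
  qed
  show "whisker_basic S x0 \<zeta> U \<subseteq> coset_rel S x0 U `` {loop_class S \<zeta>}"
    using assms(2) by (auto simp: whisker_basic_def coset_rel_def)
qed

lemma equiv_coset_rel:
  assumes "U \<subseteq> S" "x0 \<in> U"
  shows "equiv (pi1 S x0) (coset_rel S x0 U)"
proof (rule equivI)
  note inS = loops_at_mono[OF assms(1), THEN subsetD]
  show "coset_rel S x0 U \<subseteq> pi1 S x0 \<times> pi1 S x0"
    using inS loops_at_join unfolding coset_rel_def pi1_def by fast
  show "refl_on (pi1 S x0) (coset_rel S x0 U)"
  proof (rule refl_onI)
    fix c assume "c \<in> pi1 S x0"
    then obtain \<zeta> where \<zeta>: "\<zeta> \<in> loops_at S x0" "c = loop_class S \<zeta>"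
      by (auto simp: pi1_def)
    then show "(c, c) \<in> coset_rel S x0 U"
      using coset_rel_image[OF assms(1) \<zeta>(1)] whisker_basic_self[OF \<zeta>(1) assms(2)] by blast
  qed
  show "sym (coset_rel S x0 U)"
  proof (rule symI)
    fix c c' assume "(c, c') \<in> coset_rel S x0 U"
    then obtain \<zeta> \<eta> where *: "\<zeta> \<in> loops_at S x0" "\<eta> \<in> loops_at U x0"
        "c = loop_class S \<zeta>" "c' = loop_class S (\<zeta> +++ \<eta>)"
      by (auto simp: coset_rel_def)
    then have "c = loop_class S ((\<zeta> +++ \<eta>) +++ reversepath \<eta>)"
      using loop_class_join_reverse_right inS by metis
    then show "(c', c) \<in> coset_rel S x0 U"
      using * loops_at_join[OF *(1) inS[OF *(2)]] loops_at_reverse[OF *(2)]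
      unfolding coset_rel_def by blast
  qed
  show "trans (coset_rel S x0 U)"
  proof (rule transI)
    fix a b c assume ab: "(a, b) \<in> coset_rel S x0 U" and bc: "(b, c) \<in> coset_rel S x0 U"
    obtain \<zeta> \<eta> where *: "\<zeta> \<in> loops_at S x0" "\<eta> \<in> loops_at U x0"
        "a = loop_class S \<zeta>" "b = loop_class S (\<zeta> +++ \<eta>)"
      using ab by (auto simp: coset_rel_def)
    have \<xi>: "\<zeta> +++ \<eta> \<in> loops_at S x0"
      using loops_at_join[OF *(1) inS[OF *(2)]] .
    have "c \<in> whisker_basic S x0 (\<zeta> +++ \<eta>) U"
      using bc coset_rel_image[OF assms(1) \<xi>] *(4) by blast
    moreover have "b \<in> whisker_basic S x0 \<zeta> U"
      using * by (auto simp: whisker_basic_def)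
    ultimately have "c \<in> whisker_basic S x0 \<zeta> U"
      using whisker_basic_absorb[OF assms(1) order_refl *(1) \<xi>] *(4) by blast
    then show "(a, c) \<in> coset_rel S x0 U"
      using coset_rel_image[OF assms(1) *(1)] *(3) by blast
  qed
qed

text \<open>
  A basic set containing \<open>c\<close> is a coset and hence the coset of \<open>c\<close> itself. So neighbourhoods can be
  centred at any of their points, in the form that the criteria of the first section need.
\<close>

lemma openin_pi1_wh_iff:
  "openin (pi1_wh S x0) W \<longleftrightarrow> W \<subseteq> pi1 S x0 \<and>
     (\<forall>c\<in>W. \<exists>U. openin (top_of_set S) U \<and> x0 \<in> U \<and> coset_rel S x0 U `` {c} \<subseteq> W)"
    (is "?lhs \<longleftrightarrow> ?rhs")
proof
  assume W: ?lhs
  have "\<exists>U. openin (top_of_set S) U \<and> x0 \<in> U \<and> coset_rel S x0 U `` {c} \<subseteq> W" if c: "c \<in> W" for c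
  proof -
    obtain B where "B \<in> whisker_basis S x0" "c \<in> B" "B \<subseteq> W"
      using W c unfolding openin_pi1_wh union_of_def arbitrary_def by blast
    then obtain \<zeta> U where *: "c \<in> whisker_basic S x0 \<zeta> U" "whisker_basic S x0 \<zeta> U \<subseteq> W"
        "\<zeta> \<in> loops_at S x0" "openin (top_of_set S) U" "x0 \<in> U"
      by (auto simp: whisker_basis_def)
    have US: "U \<subseteq> S"
      using *(4) openin_imp_subset by blast
    have "(loop_class S \<zeta>, c) \<in> coset_rel S x0 U"
      using coset_rel_image[OF US *(3)] *(1) by blast
    then have "coset_rel S x0 U `` {c} = whisker_basic S x0 \<zeta> U"
      using equiv_class_eq[OF equiv_coset_rel[OF US *(5)]] coset_rel_image[OF US *(3)] by metis
    then show ?thesis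
      using * by blast
  qed
  moreover have "W \<subseteq> pi1 S x0"
    using openin_subset[OF W] by (simp add: topspace_pi1_wh)
  ultimately show ?rhs by blast
next
  assume R: ?rhs
  have "\<exists>B. openin (pi1_wh S x0) B \<and> c \<in> B \<and> B \<subseteq> W" if c: "c \<in> W" for c
  proof -
    obtain U where U: "openin (top_of_set S) U" "x0 \<in> U" "coset_rel S x0 U `` {c} \<subseteq> W"
      using R c by blast
    obtain \<zeta> where \<zeta>: "\<zeta> \<in> loops_at S x0" "c = loop_class S \<zeta>"
      using R c by (auto simp: pi1_def)
    have "whisker_basic S x0 \<zeta> U \<in> whisker_basis S x0"
      using \<zeta> U unfolding whisker_basis_def by blast
    then have "openin (pi1_wh S x0) (whisker_basic S x0 \<zeta> U)"
      unfolding openin_pi1_wh by (simp add: arbitrary_def union_of_inc)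
    moreover have "whisker_basic S x0 \<zeta> U \<subseteq> W"
      using coset_rel_image[OF openin_imp_subset[OF U(1)] \<zeta>(1)] U(3) \<zeta>(2) by simp
    ultimately show ?thesis
      using whisker_basic_self[OF \<zeta>(1) U(2)] \<zeta>(2) by blast
  qed
  then show ?lhs
    by (subst openin_subopen) blast
qed

section \<open>Homogeneity\<close>

text \<open>
  Left multiplication by the class of \<open>\<gamma>\<close>. All members of \<open>c\<close> give the same class, so the union
  is a single class.
\<close>

definition left_translation ::
    "'a::topological_space set \<Rightarrow> (real \<Rightarrow> 'a) \<Rightarrow> (real \<Rightarrow> 'a) set \<Rightarrow> (real \<Rightarrow> 'a) set" where
  "left_translation S \<gamma> c = (\<Union>p\<in>c. loop_class S (\<gamma> +++ p))"

lemma left_translation_loop_class: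
  assumes "\<gamma> \<in> loops_at S x" "p \<in> loops_at S x"
  shows "left_translation S \<gamma> (loop_class S p) = loop_class S (\<gamma> +++ p)"
proof -
  have "loop_class S (\<gamma> +++ q) = loop_class S (\<gamma> +++ p)" if "q \<in> loop_class S p" for q
  proof (rule loop_class_eqI)
    show "homotopic_paths S (\<gamma> +++ q) (\<gamma> +++ p)"
      using that assms homotopic_paths_imp_pathstart[of S p q]
      by (intro homotopic_paths_join)
         (auto simp: loops_at_def loop_class_def intro: homotopic_paths_sym)
  qed
  moreover have "p \<in> loop_class S p"
    using assms by (auto simp: loops_at_def loop_class_def)
  ultimately show ?thesis
    unfolding left_translation_def by blast
qed

lemma left_translation_coset_rel:
  assumes "\<gamma> \<in> loops_at S x0" "U \<subseteq> S" "(c, c') \<in> coset_rel S x0 U"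
  shows "(left_translation S \<gamma> c, left_translation S \<gamma> c') \<in> coset_rel S x0 U"
proof -
  obtain \<zeta> \<eta> where *: "\<zeta> \<in> loops_at S x0" "\<eta> \<in> loops_at U x0"
      "c = loop_class S \<zeta>" "c' = loop_class S (\<zeta> +++ \<eta>)"
    using assms(3) by (auto simp: coset_rel_def)
  have \<eta>: "\<eta> \<in> loops_at S x0"
    using *(2) loops_at_mono[OF assms(2)] by blast
  have "left_translation S \<gamma> c' = loop_class S ((\<gamma> +++ \<zeta>) +++ \<eta>)"
    using left_translation_loop_class[OF assms(1) loops_at_join[OF *(1) \<eta>]]
      loop_class_assoc[OF assms(1) *(1) \<eta>] *(4) by simp
  moreover have "left_translation S \<gamma> c = loop_class S (\<gamma> +++ \<zeta>)"
    using left_translation_loop_class[OF assms(1) *(1)] *(3) by simp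
  ultimately show ?thesis
    using loops_at_join[OF assms(1) *(1)] *(2) unfolding coset_rel_def by blast
qed

lemma continuous_map_left_translation:
  assumes "\<gamma> \<in> loops_at S x0"
  shows "continuous_map (pi1_wh S x0) (pi1_wh S x0) (left_translation S \<gamma>)"
  unfolding continuous_map topspace_pi1_wh
proof (intro conjI allI impI)
  show into: "left_translation S \<gamma> ` pi1 S x0 \<subseteq> pi1 S x0"
    using assms by (auto simp: pi1_def left_translation_loop_class loops_at_join)
  fix W assume W: "openin (pi1_wh S x0) W"
  let ?V = "{c \<in> pi1 S x0. left_translation S \<gamma> c \<in> W}"
  show "openin (pi1_wh S x0) ?V"
    unfolding openin_pi1_wh_iff
  proof (intro conjI ballI)
    fix c assume c: "c \<in> ?V"
    then obtain U where U: "openin (top_of_set S) U" "x0 \<in> U"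
        "coset_rel S x0 U `` {left_translation S \<gamma> c} \<subseteq> W"
      using W unfolding openin_pi1_wh_iff by blast
    have US: "U \<subseteq> S"
      using U(1) openin_imp_subset by blast
    have "coset_rel S x0 U `` {c} \<subseteq> pi1 S x0"
      using equiv_type[OF equiv_coset_rel[OF US U(2)]] by blast
    moreover have "left_translation S \<gamma> c' \<in> W" if "c' \<in> coset_rel S x0 U `` {c}" for c'
      using left_translation_coset_rel[OF assms US] that U(3) by blast
    ultimately show "\<exists>U. openin (top_of_set S) U \<and> x0 \<in> U \<and> coset_rel S x0 U `` {c} \<subseteq> ?V"
      using U by blast
  qed auto
qed

lemma homeomorphic_map_left_translation:
  assumes "\<gamma> \<in> loops_at S x0"
  shows "homeomorphic_map (pi1_wh S x0) (pi1_wh S x0) (left_translation S \<gamma>)"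
  unfolding homeomorphic_map_maps
proof (intro exI)
  show "homeomorphic_maps (pi1_wh S x0) (pi1_wh S x0)
      (left_translation S \<gamma>) (left_translation S (reversepath \<gamma>))"
    using assms loops_at_reverse[OF assms]
    by (auto simp: homeomorphic_maps_def topspace_pi1_wh pi1_def continuous_map_left_translation
        left_translation_loop_class loops_at_join loop_class_reverse_cancel
        loop_class_cancel_reverse)
qed

lemma homogeneous_space_pi1_wh: "homogeneous_space (pi1_wh S x0)"
  unfolding homogeneous_space_def topspace_pi1_wh
proof (intro ballI)
  fix a b assume "a \<in> pi1 S x0" "b \<in> pi1 S x0"
  then obtain \<zeta> \<xi> where \<zeta>: "\<zeta> \<in> loops_at S x0" "a = loop_class S \<zeta>"
      and \<xi>: "\<xi> \<in> loops_at S x0" "b = loop_class S \<xi>"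
    by (auto simp: pi1_def)
  let ?\<gamma> = "\<xi> +++ reversepath \<zeta>"
  have \<gamma>: "?\<gamma> \<in> loops_at S x0"
    using loops_at_join[OF \<xi>(1) loops_at_reverse[OF \<zeta>(1)]] .
  have "left_translation S ?\<gamma> a = b"
    using left_translation_loop_class[OF \<gamma> \<zeta>(1)] \<zeta>(2) \<xi>(2)
      loop_class_join_reverse_right[OF \<xi>(1) loops_at_reverse[OF \<zeta>(1)]] by simp
  then show "\<exists>f. homeomorphic_map (pi1_wh S x0) (pi1_wh S x0) f \<and> f a = b"
    using homeomorphic_map_left_translation[OF \<gamma>] by blast
qed

section \<open>Zero-dimensionality and metrizability\<close>

lemma zero_dimensional_space_pi1_wh: "zero_dimensional_space (pi1_wh S x0)"
proof (rule zero_dimensional_space_if_equivs)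
  let ?\<E> = "coset_rel S x0 ` {U. openin (top_of_set S) U \<and> x0 \<in> U}"
  show "equiv (pi1 S x0) E" if "E \<in> ?\<E>" for E
    using that by (auto intro!: equiv_coset_rel dest: openin_imp_subset)
  show "openin (pi1_wh S x0) W \<longleftrightarrow> W \<subseteq> pi1 S x0 \<and> (\<forall>c\<in>W. \<exists>E\<in>?\<E>. E `` {c} \<subseteq> W)" for W
    by (simp add: openin_pi1_wh_iff conj_assoc)
qed

text \<open>
  If \<open>a\<close> and \<open>b\<close> share a coset for every \<open>U\<close>, then the quotient \<open>a\<^sup>-\<^sup>1 b\<close>, represented by \<open>\<mu>\<close> in
  the proof, has representatives in arbitrarily small neighbourhoods of \<open>x0\<close>, which the
  homotopically Hausdorff property allows only for the trivial class.
\<close>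

lemma coset_rel_separates:
  assumes hh: "homotopically_hausdorff_at S x0"
    and rel: "\<And>U. openin (top_of_set S) U \<Longrightarrow> x0 \<in> U \<Longrightarrow> (a, b) \<in> coset_rel S x0 U"
    and "x0 \<in> S"
  shows "a = b"
proof -
  have "(a, b) \<in> coset_rel S x0 S"
    using rel[of S] \<open>x0 \<in> S\<close> by simp
  then obtain \<zeta> \<mu> where \<zeta>: "\<zeta> \<in> loops_at S x0" "a = loop_class S \<zeta>"
    and \<mu>: "\<mu> \<in> loops_at S x0" and b: "b = loop_class S (\<zeta> +++ \<mu>)"
    by (auto simp: coset_rel_def)
  have "loop_class S \<mu> = pi1_one S x0"
  proof (rule ccontr)
    assume "loop_class S \<mu> \<noteq> pi1_one S x0"
    then have "loop_class S \<mu> \<in> pi1 S x0 - {pi1_one S x0}"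
      using \<mu> by (auto simp: pi1_def)
    then obtain U where U: "openin (top_of_set S) U" "x0 \<in> U"
        "loop_class S \<mu> \<notin> pi1_incl S ` pi1 U x0"
      using hh unfolding homotopically_hausdorff_at_def by blast
    have US: "U \<subseteq> S"
      using U(1) openin_imp_subset by blast
    have "b \<in> whisker_basic S x0 \<zeta> U"
      using rel[OF U(1,2)] coset_rel_image[OF US \<zeta>(1)] \<zeta>(2) by blast
    then obtain \<eta> where \<eta>: "\<eta> \<in> loops_at U x0" "b = loop_class S (\<zeta> +++ \<eta>)"
      by (auto simp: whisker_basic_def)
    have \<eta>S: "\<eta> \<in> loops_at S x0"
      using \<eta>(1) loops_at_mono[OF US] by blast
    note rev = loops_at_reverse[OF \<zeta>(1)]
    have "loop_class S \<mu> = loop_class S (reversepath \<zeta> +++ (\<zeta> +++ \<mu>))"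
      using loop_class_reverse_cancel[OF \<zeta>(1) \<mu>] by simp
    also have "\<dots> = loop_class S (reversepath \<zeta> +++ (\<zeta> +++ \<eta>))"
      using b \<eta>(2)
        loop_class_join_cong[OF rev loops_at_join[OF \<zeta>(1) \<mu>] rev loops_at_join[OF \<zeta>(1) \<eta>S] refl]
      by simp
    also have "\<dots> = loop_class S \<eta>"
      by (rule loop_class_reverse_cancel[OF \<zeta>(1) \<eta>S])
    also have "\<dots> = pi1_incl S (loop_class U \<eta>)"
      using pi1_incl_loop_class[OF \<eta>(1) US] by simp
    finally show False
      using U(3) \<eta>(1) by (auto simp: pi1_def)
  qed
  then have "loop_class S (\<zeta> +++ \<mu>) = loop_class S (\<zeta> +++ (\<lambda>t. x0))"
    using loop_class_join_cong[OF \<zeta>(1) \<mu> \<zeta>(1) loops_at_const[OF \<open>x0 \<in> S\<close>] refl]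
    by (simp add: pi1_one_def)
  then show ?thesis
    using loop_class_eqI[OF homotopic_paths_const_right[OF \<zeta>(1)]] \<zeta>(2) b by simp
qed

lemma metrizable_space_pi1_wh:
  assumes "metrizable_space (top_of_set S)" "homotopically_hausdorff_at S x0" "x0 \<in> S"
  shows "metrizable_space (pi1_wh S x0)"
proof -
  obtain M d where Md: "Metric_space M d" "top_of_set S = Metric_space.mtopology M d"
    using assms(1) by (auto simp: metrizable_space_def)
  interpret Metric_space M d by (rule Md(1))
  have "x0 \<in> M"
    using arg_cong[OF Md(2), of topspace] assms(3) by simp
  define U where "U n = mball x0 (inverse (real (Suc n)))" for n
  have U: "openin (top_of_set S) (U n)" "x0 \<in> U n" for n
    unfolding U_def Md(2) using \<open>x0 \<in> M\<close> by simp_all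
  have US: "U n \<subseteq> S" for n
    using U(1) openin_imp_subset by blast
  have small: "\<exists>n. U n \<subseteq> V" if V: "openin (top_of_set S) V" "x0 \<in> V" for V
  proof -
    obtain r where r: "r > 0" "mball x0 r \<subseteq> V"
      using V unfolding Md(2) openin_mtopology by blast
    obtain n where "inverse (real (Suc n)) < r"
      using reals_Archimedean[OF r(1)] by blast
    then have "U n \<subseteq> mball x0 r"
      unfolding U_def by (intro mball_subset_concentric) simp
    then show ?thesis
      using r(2) by blast
  qed
  show ?thesis
  proof (rule metrizable_space_if_equivs)
    let ?E = "\<lambda>n. coset_rel S x0 (U n)"
    show "equiv (pi1 S x0) (?E n)" for n
      by (rule equiv_coset_rel[OF US U(2)])
    show "decseq ?E"
      unfolding decseq_def U_def
      by (intro allI impI coset_rel_mono mball_subset_concentric) (simp add: field_simps)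
    show "(\<Inter>n. ?E n) \<subseteq> Id"
    proof (rule subrelI)
      fix a b assume ab: "(a, b) \<in> (\<Inter>n. ?E n)"
      have "(a, b) \<in> coset_rel S x0 V" if "openin (top_of_set S) V" "x0 \<in> V" for V
        using small[OF that] coset_rel_mono ab by blast
      then show "(a, b) \<in> Id"
        using coset_rel_separates[OF assms(2) _ assms(3)] by auto
    qed
    show "openin (pi1_wh S x0) W \<longleftrightarrow> W \<subseteq> pi1 S x0 \<and> (\<forall>c\<in>W. \<exists>n. ?E n `` {c} \<subseteq> W)" for W
    proof -
      have "(\<exists>V. openin (top_of_set S) V \<and> x0 \<in> V \<and> coset_rel S x0 V `` {c} \<subseteq> W) \<longleftrightarrow>
          (\<exists>n. ?E n `` {c} \<subseteq> W)" for c
        using U small coset_rel_mono by (meson Image_mono order_refl order_trans)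
      then show ?thesis
        unfolding openin_pi1_wh_iff by simp
    qed
  qed
qed

theorem theorem5p6:
  fixes X :: "'a::topological_space set" and x0 :: 'a
  assumes "path_connected X"
    and "locally path_connected X"
    and "metrizable_space (top_of_set X)"
    and "homotopically_hausdorff X"
    and "x0 \<in> X"
  shows "homogeneous_space (pi1_wh X x0) \<and> zero_dimensional_space (pi1_wh X x0) \<and>
         metrizable_space (pi1_wh X x0)"
proof (intro conjI homogeneous_space_pi1_wh zero_dimensional_space_pi1_wh)
  show "metrizable_space (pi1_wh X x0)"
    using assms(3-5) by (intro metrizable_space_pi1_wh) (auto simp: homotopically_hausdorff_def)
qed

end
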